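(* Let $T$ be a tree on $n \ge 4$ vertices with edge set $\{e_1,\ldots,e_{n-1}\}$ and let $k$ be an integer such that $3 \le k \le n-3$. Then the data $\theta_T(\{e_{i_1},\ldots,e_{i_k}\})$ for all choices of $k$ distinct edges $e_{i_1},\ldots,e_{i_k}$ uniquely determines $T$. That is: if $T'$ is another tree on $n$ vertices with edge set $\{e'_1,\ldots,e'_{n-1}\}$ such that $\theta_T(\{e_i : i \in I\}) = \theta_{T'}(\{e'_i : i \in I\})$ for every $I \subseteq \{1,\ldots,n-1\}$ with $|I| = k$, then $T$ and $T'$ are isomorphic.
   Context: For a tree $T$ on $n$ vertices with edge set $E$ and a subset $S \subseteq E$, $\theta_T(S)$ denotes the integer partition of $n$ (of $|S|+1$ parts) whose parts are the numbers of vertices of the connected components of the graph obtained from $T$ by removing every edge of $S$ (keeping all vertices). The data considered is labeled: for each $k$-element subset $S$ of edges one knows the corresponding partition $\theta_T(S)$, not merely the multiset of all these partitions. *)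

theory Defs
  imports "HOL-Library.Multiset"
begin

text \<open>A finite simple graph is given by its vertex set \<open>V\<close> and its set \<open>E\<close> of edges,
  an edge being the two-element set of its end points.\<close>

definition simple_graph :: "'a set \<Rightarrow> 'a set set \<Rightarrow> bool" where
  "simple_graph V E \<longleftrightarrow> finite V \<and> (\<forall>e\<in>E. e \<subseteq> V \<and> card e = 2)"

definition adj :: "'a set set \<Rightarrow> ('a \<times> 'a) set" where
  "adj E = {(u, v). {u, v} \<in> E}"

definition connected_graph :: "'a set \<Rightarrow> 'a set set \<Rightarrow> bool" where
  "connected_graph V E \<longleftrightarrow> V \<noteq> {} \<and> (\<forall>u\<in>V. \<forall>v\<in>V. (u, v) \<in> (adj E)\<^sup>*)"

text \<open>A cycle is the list of its vertices, the first one not being repeated at the end.\<close>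

definition graph_cycle :: "'a set set \<Rightarrow> 'a list \<Rightarrow> bool" where
  "graph_cycle E c \<longleftrightarrow>
     3 \<le> length c \<and> distinct c \<and> successively (\<lambda>u v. {u, v} \<in> E) c \<and> {last c, hd c} \<in> E"

definition tree_graph :: "'a set \<Rightarrow> 'a set set \<Rightarrow> bool" where
  "tree_graph V E \<longleftrightarrow> simple_graph V E \<and> connected_graph V E \<and> (\<nexists>c. graph_cycle E c)"

text \<open>The vertex sets of the connected components; an isolated vertex is a component.\<close>

definition graph_components :: "'a set \<Rightarrow> 'a set set \<Rightarrow> 'a set set" where
  "graph_components V E = V // ((adj E)\<^sup>* \<inter> V \<times> V)"

text \<open>\<open>theta V E S\<close> is the integer partition \<open>\<theta>\<^sub>T(S)\<close> for the tree \<open>T = (V, E)\<close>.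
  An integer partition is the multiset of its parts.\<close>

definition theta :: "'a set \<Rightarrow> 'a set set \<Rightarrow> 'a set set \<Rightarrow> nat multiset" where
  "theta V E S = image_mset card (mset_set (graph_components V (E - S)))"

definition graph_isomorphic :: "'a set \<Rightarrow> 'a set set \<Rightarrow> 'b set \<Rightarrow> 'b set set \<Rightarrow> bool" where
  "graph_isomorphic V E V' E' \<longleftrightarrow>
     (\<exists>f. bij_betw f V V' \<and> (\<forall>u\<in>V. \<forall>v\<in>V. {u, v} \<in> E \<longleftrightarrow> {f u, f v} \<in> E'))"

end

theory Submission
  imports Defs
begin

text \<open>Let \<open>|S| = k - 1\<close> and let \<open>R\<close> be the forest left after removing \<open>S\<close>. Every edge of \<open>R\<close>
  gives a known refinement of \<open>\<theta>(S)\<close>, in which one part is split in two. Suppose two trees agree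
  on these refinements. As \<open>|R| \<ge> 3\<close>, comparing the numbers of parts equal to 1 shows that a leaf
  edge of one forest is a leaf edge of the other; comparing the refinements at a leaf edge of a
  smallest nontrivial component then gives the same \<open>\<theta>(S)\<close>. Descending, \<open>\<theta>\<close> is
  determined on all sets of at most three edges.

  The sum of the squares of the parts of \<open>\<theta>(S)\<close> is the number of ordered pairs of vertices
  whose path avoids \<open>S\<close>. From sets of at most three edges, inclusion-exclusion decides whether
  an edge \<open>h\<close> lies on every path through \<open>f\<close> and \<open>g\<close>, hence whether \<open>f\<close> and \<open>g\<close> are
  adjacent. Finally, a tree on at least three vertices is determined by the adjacency of its edges,
  since it has no triangles.\<close>

section \<open>Connectedness and deletion of an edge\<close>

abbreviation component :: "'a set set \<Rightarrow> 'a \<Rightarrow> 'a set" where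
  "component R v \<equiv> (adj R)\<^sup>* `` {v}"

text \<open>Acyclicity is expressed by every edge being a bridge. In this form it passes at once to
  subsets of the edges, and it yields directly the two disjoint sides of an edge.\<close>

definition forest :: "'a set \<Rightarrow> 'a set set \<Rightarrow> bool" where
  "forest V R \<longleftrightarrow> simple_graph V R \<and> (\<forall>x y. {x, y} \<in> R \<longrightarrow> (x, y) \<notin> (adj (R - {{x, y}}))\<^sup>*)"

lemma conn_sym: "(u, v) \<in> (adj R)\<^sup>* \<Longrightarrow> (v, u) \<in> (adj R)\<^sup>*"
proof -
  have "sym (adj R)" by (auto simp: sym_def adj_def insert_commute)
  then show "(u, v) \<in> (adj R)\<^sup>* \<Longrightarrow> (v, u) \<in> (adj R)\<^sup>*"
    by (meson sym_rtrancl symD)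
qed

lemma conn_mono: "(u, v) \<in> (adj R)\<^sup>* \<Longrightarrow> R \<subseteq> R' \<Longrightarrow> (u, v) \<in> (adj R')\<^sup>*"
  by (rule rtrancl_mono[THEN subsetD, of "adj R"]) (auto simp: adj_def)

lemma conn_edge: "{u, v} \<in> R \<Longrightarrow> (u, v) \<in> (adj R)\<^sup>*"
  by (auto simp: adj_def)

text \<open>A walk that uses \<open>{x, y}\<close> can be cut down to its stretch before the first
  use and its stretch after the last one; if these meet at the same vertex, the edge is avoided
  altogether.\<close>

lemma conn_delete:
  assumes "(u, v) \<in> (adj R)\<^sup>*"
  shows "(u, v) \<in> (adj (R - {{x, y}}))\<^sup>*
    \<or> (u, x) \<in> (adj (R - {{x, y}}))\<^sup>* \<and> (y, v) \<in> (adj (R - {{x, y}}))\<^sup>*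
    \<or> (u, y) \<in> (adj (R - {{x, y}}))\<^sup>* \<and> (x, v) \<in> (adj (R - {{x, y}}))\<^sup>*"
  using assms
proof (induction rule: rtrancl_induct)
  case base
  then show ?case by simp
next
  case (step b c)
  show ?case
  proof (cases "{b, c} = {x, y}")
    case True
    then have "b = x \<and> c = y \<or> b = y \<and> c = x" by (auto simp: doubleton_eq_iff)
    then show ?thesis using step.IH by auto
  next
    case False
    then have "(b, c) \<in> adj (R - {{x, y}})" using step.hyps by (auto simp: adj_def)
    then show ?thesis using step.IH by (meson rtrancl.rtrancl_into_rtrancl)
  qed
qed

lemma component_eq: "w \<in> component R v \<Longrightarrow> component R w = component R v"
proof -
  assume "w \<in> component R v"
  then have vw: "(v, w) \<in> (adj R)\<^sup>*" by simp
  note wv = conn_sym[OF vw]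
  show ?thesis using rtrancl_trans[OF vw] rtrancl_trans[OF wv] by auto
qed

lemma component_subset:
  assumes "simple_graph V R" "v \<in> V"
  shows "component R v \<subseteq> V"
proof
  fix w assume "w \<in> component R v"
  then have "(v, w) \<in> (adj R)\<^sup>*" by simp
  then show "w \<in> V" using assms
    by (induction rule: rtrancl_induct) (auto simp: adj_def simple_graph_def)
qed

lemma edge_endpoints:
  assumes "simple_graph V R" "f \<in> R"
  obtains x y where "f = {x, y}" "x \<noteq> y" "x \<in> V" "y \<in> V"
  using assms unfolding simple_graph_def by (metis card_2_iff insert_subset)

lemma other_endpoint:
  assumes "simple_graph V R" "f \<in> R" "v \<in> f"
  obtains w where "f = {v, w}" "v \<noteq> w" "w \<in> V"
  using assms(1,2)
proof (rule edge_endpoints)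
  fix x y assume "f = {x, y}" "x \<noteq> y" "x \<in> V" "y \<in> V"
  then show thesis using assms(3) that[of x] that[of y] by (auto simp: insert_commute)
qed

lemma finite_edges: "simple_graph V R \<Longrightarrow> finite R"
  unfolding simple_graph_def by (meson Pow_iff finite_Pow_iff finite_subset subsetI)

lemma forest_simple: "forest V R \<Longrightarrow> simple_graph V R"
  by (simp add: forest_def)

lemma forest_bridge: "forest V R \<Longrightarrow> {x, y} \<in> R \<Longrightarrow> (x, y) \<notin> (adj (R - {{x, y}}))\<^sup>*"
  by (simp add: forest_def)

lemma forest_mono:
  assumes "forest V R" "R' \<subseteq> R"
  shows "forest V R'"
proof -
  have "(x, y) \<notin> (adj (R' - {{x, y}}))\<^sup>*" if "{x, y} \<in> R'" for x y
    using assms conn_mono[of x y "R' - {{x, y}}" "R - {{x, y}}"] that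
    by (auto simp: forest_def)
  then show ?thesis using assms by (auto simp: forest_def simple_graph_def)
qed

lemma simple_path_exists:
  assumes "(x, y) \<in> (adj F)\<^sup>*"
  shows "\<exists>p. p \<noteq> [] \<and> hd p = x \<and> last p = y \<and> distinct p \<and> successively (\<lambda>u v. {u, v} \<in> F) p"
  using assms
proof (induction rule: rtrancl_induct)
  case base
  then show ?case by (intro exI[of _ "[x]"]) simp
next
  case (step b c)
  then obtain p where p: "p \<noteq> []" "hd p = x" "last p = b" "distinct p"
    "successively (\<lambda>u v. {u, v} \<in> F) p" by blast
  show ?case
  proof (cases "c \<in> set p")
    \<comment> \<open>A path that has already visited \<open>c\<close> is cut off at that
      visit.\<close>
    case True
    then obtain q r where "p = q @ c # r" by (meson split_list)
    then show ?thesis using p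
      by (intro exI[of _ "q @ [c]"]) (auto simp: successively_append_iff hd_append)
  next
    case False
    then show ?thesis using p step.hyps
      by (intro exI[of _ "p @ [c]"]) (auto simp: successively_append_iff adj_def)
  qed
qed

text \<open>A simple path joining the ends of an edge without using it would close up with that edge
  to a cycle.\<close>

lemma tree_imp_forest:
  assumes "tree_graph V E"
  shows "forest V E"
  unfolding forest_def
proof (intro conjI allI impI notI)
  show simple: "simple_graph V E" using assms by (simp add: tree_graph_def)
  fix x y assume xy: "{x, y} \<in> E" and "(x, y) \<in> (adj (E - {{x, y}}))\<^sup>*"
  then obtain p where p: "p \<noteq> []" "hd p = x" "last p = y" "distinct p"
    "successively (\<lambda>u v. {u, v} \<in> E - {{x, y}}) p" using simple_path_exists by metis
  have "x \<noteq> y" using xy simple by (auto simp: simple_graph_def)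
  then obtain q where q: "p = x # q" "q \<noteq> []" using p
    by (metis last.simps list.collapse)
  moreover obtain z r where "q = z # r" using q(2) by (cases q) auto
  \<comment> \<open>A path with only two vertices would run along the deleted edge itself.\<close>
  moreover have "r \<noteq> []" using p calculation by auto
  ultimately have "3 \<le> length p" by (cases r) auto
  moreover have "successively (\<lambda>u v. {u, v} \<in> E) p"
    using p(5) by (rule successively_mono) auto
  ultimately have "graph_cycle E p"
    using p xy by (simp add: graph_cycle_def insert_commute)
  then show False using assms by (auto simp: tree_graph_def)
qed

lemma component_delete:
  assumes "{x, y} \<in> R"
  shows "component R x = component (R - {{x, y}}) x \<union> component (R - {{x, y}}) y"
proof -
  have "(x, y) \<in> (adj R)\<^sup>*" using assms by (rule conn_edge)
  then have "(x, z) \<in> (adj R)\<^sup>*" if "(y, z) \<in> (adj R)\<^sup>*" for z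
    using that by (rule rtrancl_trans)
  then show ?thesis
    using conn_delete[of x _ R x y] conn_mono[of _ _ "R - {{x, y}}" R] by blast
qed

lemma component_delete_other:
  assumes "{x, y} \<in> R" "z \<notin> component R x"
  shows "component (R - {{x, y}}) z = component R z"
proof -
  have "(x, z) \<notin> (adj R)\<^sup>*" using assms(2) by simp
  then have "(z, x) \<notin> (adj R)\<^sup>*" "(z, y) \<notin> (adj R)\<^sup>*"
    using conn_sym[of z _ R] rtrancl_trans[OF conn_edge[OF assms(1)], of z] by blast+
  then show ?thesis
    using conn_delete[of z _ R x y] conn_mono[of _ _ "R - {{x, y}}" R] by blast
qed

lemma sides_disjoint:
  assumes "forest V R" "{x, y} \<in> R"
  shows "component (R - {{x, y}}) x \<inter> component (R - {{x, y}}) y = {}"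
  using forest_bridge[OF assms] conn_sym[of y _ "R - {{x, y}}"]
    rtrancl_trans[of x _ "adj (R - {{x, y}})" y] by blast

lemma graph_components_eq:
  assumes "simple_graph V R"
  shows "graph_components V R = component R ` V"
proof -
  have "((adj R)\<^sup>* \<inter> V \<times> V) `` {v} = component R v" if "v \<in> V" for v
    using component_subset[OF assms that] that by auto
  then show ?thesis by (auto simp: graph_components_def quotient_def)
qed

lemma finite_component:
  "simple_graph V R \<Longrightarrow> v \<in> V \<Longrightarrow> finite (component R v)"
  using component_subset finite_subset unfolding simple_graph_def by metis

lemma card_component_pos:
  "simple_graph V R \<Longrightarrow> v \<in> V \<Longrightarrow> 0 < card (component R v)"
  using finite_component by (fastforce simp: card_gt_0_iff)

section \<open>The parts of a forest\<close>

text \<open>Running over the end points of \<open>f\<close> gives an unordered pair of side sizes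
  that keeps repetitions. In a forest, its sum is the size of the component containing the edge
  \<open>f\<close>.\<close>

definition edge_parts :: "'a set set \<Rightarrow> 'a set \<Rightarrow> nat multiset" where
  "edge_parts R f = image_mset (\<lambda>x. card (component (R - {f}) x)) (mset_set f)"

lemma edge_parts_pair:
  "x \<noteq> y \<Longrightarrow> edge_parts R {x, y} =
    {#card (component (R - {{x, y}}) x), card (component (R - {{x, y}}) y)#}"
  by (simp add: edge_parts_def)

lemma sum_edge_parts:
  assumes "forest V R" "{x, y} \<in> R"
  shows "sum_mset (edge_parts R {x, y}) = card (component R x)"
proof -
  have simple: "simple_graph V (R - {{x, y}})"
    using assms by (auto simp: forest_def simple_graph_def)
  have "x \<noteq> y" "x \<in> V" "y \<in> V" using assms by (auto simp: forest_def simple_graph_def)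
  then show ?thesis
    using sides_disjoint[OF assms] component_delete[OF assms(2)]
      finite_component[OF simple] by (simp add: edge_parts_pair card_Un_disjoint)
qed

text \<open>One component is replaced by the two sides of \<open>f\<close>. Adding the lost part on
  the left avoids subtraction of multisets.\<close>

lemma theta_delete_edge:
  assumes "forest V R" "f \<in> R"
  shows "theta V R {f} + {#sum_mset (edge_parts R f)#} = theta V R {} + edge_parts R f"
proof -
  have R: "simple_graph V R" using assms(1) by (rule forest_simple)
  then obtain x y where f: "f = {x, y}" "x \<noteq> y" "x \<in> V" "y \<in> V"
    using assms(2) by (rule edge_endpoints)
  let ?Q = "R - {{x, y}}"
  have Q: "simple_graph V ?Q" using R by (auto simp: simple_graph_def)
  have xy: "{x, y} \<in> R" using assms f by simp
  \<comment> \<open>The components that do not contain \<open>f\<close>; they survive the deletion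
    unchanged.\<close>
  define G where "G = component R ` (V - component R x)"
  have fin: "finite G" using R by (simp add: G_def simple_graph_def)
  have "component R ` V = insert (component R x) G"
    using f component_eq[of _ R x] unfolding G_def by blast
  then have cR: "graph_components V R = insert (component R x) G"
    using graph_components_eq[OF R] by simp
  have GQ: "G = component ?Q ` (V - component R x)"
    unfolding G_def using component_delete_other[OF xy] by (intro image_cong) auto
  have "component ?Q ` V = insert (component ?Q x) (insert (component ?Q y) G)"
  proof
    show "component ?Q ` V \<subseteq> insert (component ?Q x) (insert (component ?Q y) G)"
      using component_eq[of _ ?Q x] component_eq[of _ ?Q y] component_delete[OF xy]
      unfolding GQ by blast
    show "insert (component ?Q x) (insert (component ?Q y) G) \<subseteq> component ?Q ` V"
      using f unfolding GQ by blast
  qed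
  then have cQ: "graph_components V ?Q = insert (component ?Q x) (insert (component ?Q y) G)"
    using graph_components_eq[OF Q] by simp
  have notin: "D \<notin> G" if "D \<subseteq> component R x" for D
    using that unfolding G_def by auto
  have new: "component R x \<notin> G" "component ?Q x \<notin> G" "component ?Q y \<notin> G"
    using notin component_delete[OF xy] by blast+
  have ne: "component ?Q x \<noteq> component ?Q y"
    using sides_disjoint[OF assms(1) xy] by blast
  have "theta V R {} = {#card (component R x)#} + image_mset card (mset_set G)"
    using cR new fin by (simp add: theta_def)
  moreover have "theta V R {f} = {#card (component ?Q x), card (component ?Q y)#}
      + image_mset card (mset_set G)"
    using cQ new ne fin f by (simp add: theta_def)
  ultimately show ?thesis
    using sum_edge_parts[OF assms(1) xy] f by (simp add: edge_parts_pair)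
qed

lemma edge_parts_pos:
  assumes "simple_graph V R" "f \<in> R"
  shows "\<exists>y z. edge_parts R f = {#y, z#} \<and> 0 < y \<and> 0 < z"
proof -
  have Q: "simple_graph V (R - {f})" using assms by (auto simp: simple_graph_def)
  obtain x y where "f = {x, y}" "x \<noteq> y" "x \<in> V" "y \<in> V" using assms by (rule edge_endpoints)
  then show ?thesis using card_component_pos[OF Q] by (auto simp: edge_parts_pair)
qed

section \<open>Edges and leaf edges inside the components of a forest\<close>

lemma neighbour_in_component:
  assumes "2 \<le> card (component R x)"
  obtains w where "{x, w} \<in> R"
proof -
  obtain v where "(x, v) \<in> (adj R)\<^sup>*" "v \<noteq> x"
    using assms by (metis Image_singleton_iff card_2_iff' card_le_Suc0_iff_eq
        card.infinite not_numeral_le_zero not_less_eq_eq numeral_2_eq_2)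
  then show ?thesis using that by (metis adj_def converse_rtranclE mem_Collect_eq case_prodD)
qed

lemma edge_of_part:
  assumes "forest V R" "s \<in># theta V R {}" "2 \<le> s"
  shows "\<exists>f\<in>R. sum_mset (edge_parts R f) = s"
proof -
  have simple: "simple_graph V R" using assms by (simp add: forest_def)
  then have "finite V" by (simp add: simple_graph_def)
  then obtain v where v: "v \<in> V" "s = card (component R v)"
    using assms(2) graph_components_eq[OF simple] by (auto simp: theta_def)
  then obtain w where "{v, w} \<in> R" using neighbour_in_component assms(3) by metis
  then show ?thesis using sum_edge_parts[OF assms(1)] v by blast
qed

text \<open>Step from \<open>x\<close> to a neighbour \<open>w\<close> other than \<open>y\<close>.
  The side of \<open>w\<close> at \<open>{x, w}\<close> lies inside the side of \<open>x\<close> and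
  misses \<open>x\<close>, so induction on the size of the side ends at a leaf.\<close>

lemma leaf_edge_in_side:
  assumes "forest V R" "{x, y} \<in> R" "2 \<le> card (component (R - {{x, y}}) x)"
  shows "\<exists>u v. {u, v} \<in> R \<and> {u, v} \<subseteq> component (R - {{x, y}}) x
    \<and> card (component (R - {{u, v}}) v) = 1"
  using assms(2,3)
proof (induction "card (component (R - {{x, y}}) x)" arbitrary: x y rule: less_induct)
  case less
  have simple: "simple_graph V R" using assms(1) by (rule forest_simple)
  let ?X = "component (R - {{x, y}}) x"
  have inV: "x \<in> V" using less.prems simple by (auto simp: simple_graph_def)
  obtain w where w: "{x, w} \<in> R - {{x, y}}" using less.prems(2) by (rule neighbour_in_component)
  have simp2: "simple_graph V (R - {{x, w}})" "simple_graph V (R - {{x, y}})"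
    using simple by (auto simp: simple_graph_def)
  have wV: "w \<in> V" using w simple by (auto simp: simple_graph_def)
  let ?W = "component (R - {{x, w}}) w"
  have bridge: "(w, x) \<notin> (adj (R - {{x, w}}))\<^sup>*"
    using forest_bridge[OF assms(1), of x w] w conn_sym[of w x] by blast
  have wX: "w \<in> ?X" using conn_edge[OF w] by simp
  have sub: "?W \<subseteq> ?X"
  proof
    fix p assume "p \<in> ?W"
    then have p: "(w, p) \<in> (adj (R - {{x, w}}))\<^sup>*" by simp
    let ?Q = "R - {{x, w}} - {{x, y}}"
    \<comment> \<open>Here \<open>y\<close> still reaches \<open>x\<close> along
      \<open>{x, y}\<close>, so reaching either of them from \<open>w\<close> would contradict that
      \<open>{x, w}\<close> is a bridge.\<close>
    have "(y, x) \<in> (adj (R - {{x, w}}))\<^sup>*"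
      using less.prems(1) w by (intro conn_edge) (auto simp: insert_commute)
    then have "(w, x) \<notin> (adj ?Q)\<^sup>*" "(w, y) \<notin> (adj ?Q)\<^sup>*"
      using bridge conn_mono[of w _ ?Q "R - {{x, w}}"]
        rtrancl_trans[of w y "adj (R - {{x, w}})" x] by blast+
    then have "(w, p) \<in> (adj ?Q)\<^sup>*" using conn_delete[OF p, of x y] by blast
    then have "(w, p) \<in> (adj (R - {{x, y}}))\<^sup>*" by (rule conn_mono) auto
    then show "p \<in> ?X" using wX rtrancl_trans[of x w _ p] by blast
  qed
  have "x \<notin> ?W" using bridge by simp
  then have smaller: "card ?W < card ?X"
    using sub finite_component[OF simp2(2) inV] by (intro psubset_card_mono) auto
  show ?case
  proof (cases "2 \<le> card ?W")
    case True
    have "R - {{w, x}} = R - {{x, w}}" by (simp add: insert_commute)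
    then have "\<exists>u v. {u, v} \<in> R \<and> {u, v} \<subseteq> ?W \<and> card (component (R - {{u, v}}) v) = 1"
      using less.hyps[of w x] smaller True w by (simp add: insert_commute)
    then show ?thesis using sub by blast
  next
    case False
    then have "card ?W = 1" using card_component_pos[OF simp2(1) wV] by linarith
    then show ?thesis using w wX by (intro exI[of _ x] exI[of _ w]) auto
  qed
qed

lemma edge_parts_leaf:
  assumes "forest V R" "{u, v} \<in> R" "card (component (R - {{u, v}}) v) = 1"
  shows "edge_parts R {u, v} = {#1, card (component R v) - 1#}"
proof -
  have "u \<noteq> v" using assms by (auto simp: forest_def simple_graph_def)
  moreover have "component R u = component R v"
    using component_eq conn_edge[OF assms(2)] by fastforce
  ultimately show ?thesis
    using sum_edge_parts[OF assms(1,2)] assms(3) by (auto simp: edge_parts_pair)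
qed

text \<open>A side of \<open>f\<close> with at least two vertices contains a leaf edge, and a side
  with one vertex makes \<open>f\<close> itself a leaf edge. With three vertices in the component,
  the two sides supply different edges.\<close>

lemma two_leaf_edges:
  assumes "forest V R" "f \<in> R" "3 \<le> sum_mset (edge_parts R f)"
  shows "\<exists>g\<in>R. \<exists>h\<in>R. g \<noteq> h \<and> edge_parts R g = {#1, sum_mset (edge_parts R f) - 1#}
    \<and> edge_parts R h = {#1, sum_mset (edge_parts R f) - 1#}"
proof -
  have side: "\<exists>g\<in>R. g \<subseteq> component (R - {f}) x
      \<and> edge_parts R g = {#1, sum_mset (edge_parts R f) - 1#}"
    if f: "f = {x, y}" and big: "2 \<le> card (component (R - {f}) x)" for x y
  proof -
    have xy: "{x, y} \<in> R" using assms f by simp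
    obtain u v where uv: "{u, v} \<in> R" "{u, v} \<subseteq> component (R - {f}) x"
      "card (component (R - {{u, v}}) v) = 1"
      using leaf_edge_in_side[OF assms(1) xy] big f by blast
    have "v \<in> component R x" using uv(2) component_delete[OF xy] f by auto
    then have "component R v = component R x" by (rule component_eq)
    then show ?thesis
      using uv edge_parts_leaf[OF assms(1) uv(1,3)] sum_edge_parts[OF assms(1) xy] f by metis
  qed
  obtain x y where f: "f = {x, y}" "x \<noteq> y" "x \<in> V" "y \<in> V"
    using forest_simple[OF assms(1)] assms(2) by (rule edge_endpoints)
  have xy: "{x, y} \<in> R" using assms f by simp
  have disj: "component (R - {f}) x \<inter> component (R - {f}) y = {}"
    using sides_disjoint[OF assms(1) xy] f by simp
  have sum: "sum_mset (edge_parts R f)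
      = card (component (R - {f}) x) + card (component (R - {f}) y)"
    using f by (simp add: edge_parts_pair)
  have nonempty: "g \<noteq> {}" if "g \<in> R" for g
    using that assms(1) by (auto simp: forest_def simple_graph_def)
  have simple: "simple_graph V (R - {f})" using assms(1) by (auto simp: forest_def simple_graph_def)
  note pos = card_component_pos[OF simple f(3)] card_component_pos[OF simple f(4)]
  \<comment> \<open>The side of \<open>a\<close> is a single vertex: the pair consists of
    \<open>f\<close> and a leaf edge inside the side of \<open>b\<close>.\<close>
  have one: ?thesis if f': "f = {a, b}" and ab: "card (component (R - {f}) a) = 1"
      "2 \<le> card (component (R - {f}) b)" and d: "component (R - {f}) a \<inter> component (R - {f}) b = {}"
    for a b
  proof -
    obtain g where g: "g \<in> R" "g \<subseteq> component (R - {f}) b"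
      "edge_parts R g = {#1, sum_mset (edge_parts R f) - 1#}"
      using side[of b a] f' ab by (auto simp: insert_commute)
    have "a \<notin> g" using g(2) d by blast
    then have "g \<noteq> f" using f' by auto
    have ba: "{b, a} \<in> R" using assms(2) f' by (simp add: insert_commute)
    then have "edge_parts R {b, a} = {#1, card (component R a) - 1#}"
      using edge_parts_leaf[OF assms(1), of b a] ab f' by (simp add: insert_commute)
    moreover have "sum_mset (edge_parts R f) = card (component R a)"
      using sum_edge_parts[OF assms(1), of a b] assms(2) f' by simp
    ultimately have "edge_parts R f = {#1, sum_mset (edge_parts R f) - 1#}"
      using f' by (simp add: insert_commute)
    then show ?thesis using g \<open>g \<noteq> f\<close> assms(2) by blast
  qed
  consider "card (component (R - {f}) x) = 1" | "card (component (R - {f}) y) = 1"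
    | "2 \<le> card (component (R - {f}) x)" "2 \<le> card (component (R - {f}) y)"
    using pos by linarith
  then show ?thesis
  proof cases
    case 1
    then show ?thesis using one[of x y] f disj sum assms(3) by auto
  next
    case 2
    then show ?thesis using one[of y x] f disj sum assms(3) by (auto simp: insert_commute)
  next
    case 3
    obtain g where g: "g \<in> R" "g \<subseteq> component (R - {f}) x"
      "edge_parts R g = {#1, sum_mset (edge_parts R f) - 1#}"
      using side[OF f(1) 3(1)] by blast
    obtain h where h: "h \<in> R" "h \<subseteq> component (R - {f}) y"
      "edge_parts R h = {#1, sum_mset (edge_parts R f) - 1#}"
      using side[of y x] f(1) 3(2) by (auto simp: insert_commute)
    have "g \<noteq> h" using g h disj nonempty by blast
    then show ?thesis using g h by blast
  qed
qed

text \<open>An edge with two one-vertex sides is, as a set of vertices, its own component, so a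
  plain inclusion of sets does the counting.\<close>

lemma isolated_edges_le:
  assumes "forest V R"
  shows "card {f \<in> R. edge_parts R f = {#1, 1#}} \<le> count (theta V R {}) 2"
proof -
  have simple: "simple_graph V R" using assms by (rule forest_simple)
  then have fin: "finite (graph_components V R)"
    by (simp add: graph_components_eq simple_graph_def)
  have "{f \<in> R. edge_parts R f = {#1, 1#}} \<subseteq> {C \<in> graph_components V R. card C = 2}"
  proof
    fix f assume "f \<in> {f \<in> R. edge_parts R f = {#1, 1#}}"
    then have f: "f \<in> R" "edge_parts R f = {#1, 1#}" by auto
    obtain x y where xy: "f = {x, y}" "x \<noteq> y" "x \<in> V" "y \<in> V"
      using simple f(1) by (rule edge_endpoints)
    have "{#card (component (R - {f}) x), card (component (R - {f}) y)#} = {#1, 1#}"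
      using f(2) xy by (simp add: edge_parts_pair)
    then have "card (component (R - {f}) x) = 1" "card (component (R - {f}) y) = 1"
      by (auto simp: add_eq_conv_ex)
    moreover have "x \<in> component (R - {f}) x" "y \<in> component (R - {f}) y" by auto
    ultimately have "component (R - {f}) x = {x}" "component (R - {f}) y = {y}"
      by (metis card_1_singletonE singletonD)+
    then have "component R x = f" using component_delete[of x y R] xy f by auto
    then show "f \<in> {C \<in> graph_components V R. card C = 2}"
      using xy graph_components_eq[OF simple] by auto
  qed
  then have "card {f \<in> R. edge_parts R f = {#1, 1#}}
      \<le> card {C \<in> graph_components V R. card C = 2}"
    using fin by (intro card_mono) auto
  also have "\<dots> = count (theta V R {}) 2"
    using fin by (simp add: theta_def count_image_mset Collect_conj_eq vimage_def Int_commute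
        flip: card_eq_sum)
  finally show ?thesis .
qed

section \<open>Recovering a partition from its refinements by one edge\<close>

text \<open>Keeps only what the comparison of two forests uses, so that it becomes a statement on
  multisets over common labels: \<open>A\<close> stands for the partition of a forest,
  \<open>J\<close> for the labels of its edges and \<open>Y j\<close> for the two sides of edge
  \<open>j\<close>.\<close>

definition forest_parts :: "nat multiset \<Rightarrow> 'i set \<Rightarrow> ('i \<Rightarrow> nat multiset) \<Rightarrow> bool" where
  "forest_parts A J Y \<longleftrightarrow>
     (\<forall>j\<in>J. \<exists>y z. Y j = {#y, z#} \<and> 0 < y \<and> 0 < z) \<and>
     (\<forall>s\<in>#A. 2 \<le> s \<longrightarrow> (\<exists>j\<in>J. sum_mset (Y j) = s)) \<and>
     (\<forall>j\<in>J. 3 \<le> sum_mset (Y j) \<longrightarrow>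
        (\<exists>g\<in>J. \<exists>h\<in>J. g \<noteq> h \<and> Y g = {#1, sum_mset (Y j) - 1#} \<and> Y h = {#1, sum_mset (Y j) - 1#})) \<and>
     card {j \<in> J. Y j = {#1, 1#}} \<le> count A 2"

lemma forest_partsD:
  assumes "forest_parts A J Y"
  shows forest_parts_pair: "j \<in> J \<Longrightarrow> \<exists>y z. Y j = {#y, z#} \<and> 0 < y \<and> 0 < z"
    and forest_parts_edge: "s \<in># A \<Longrightarrow> 2 \<le> s \<Longrightarrow> \<exists>j\<in>J. sum_mset (Y j) = s"
    and forest_parts_two_leaves: "j \<in> J \<Longrightarrow> 3 \<le> sum_mset (Y j) \<Longrightarrow>
      \<exists>g\<in>J. \<exists>h\<in>J. g \<noteq> h \<and> Y g = {#1, sum_mset (Y j) - 1#} \<and> Y h = {#1, sum_mset (Y j) - 1#}"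
    and forest_parts_isolated: "card {j \<in> J. Y j = {#1, 1#}} \<le> count A 2"
  using assms by (auto simp: forest_parts_def)

lemma forest_parts_cases:
  assumes "forest_parts A J Y" "j \<in> J"
  shows "Y j = {#1, 1#} \<or> 3 \<le> sum_mset (Y j)"
proof -
  obtain y z where yz: "Y j = {#y, z#}" "0 < y" "0 < z" using forest_parts_pair[OF assms] by blast
  show ?thesis
  proof (cases "y = 1 \<and> z = 1")
    case False
    then show ?thesis using yz by (simp, linarith)
  qed (use yz in simp)
qed

lemma forest_parts_leaf:
  assumes "forest_parts A J Y" "j \<in> J"
  shows "\<exists>g\<in>J. Y g = {#1, sum_mset (Y j) - 1#}"
  using forest_parts_cases[OF assms] forest_parts_two_leaves[OF assms] assms(2) by force

lemma forest_parts_all_ones: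
  assumes "forest_parts A J Y" "j \<in> J" "2 \<le> count (Y j) 1"
  shows "Y j = {#1, 1#}"
proof -
  obtain y z where yz: "Y j = {#y, z#}" using forest_parts_pair[OF assms(1,2)] by blast
  then show ?thesis using assms(3) by (auto split: if_splits)
qed

text \<open>If every edge loses an end point of degree one in passing from the first forest to the second,
  then the first forest is a matching on the leaf edges of the second, whose components all have
  three vertices; counting parts equal to 2 leaves room for two edges only.\<close>

lemma refinements_count_ones:
  assumes A: "forest_parts A J Y" and B: "forest_parts B J Y'"
    and J: "finite J" "3 \<le> card J"
    and eq: "\<And>j. j \<in> J \<Longrightarrow> A + Y j + {#sum_mset (Y' j)#} = B + Y' j + {#sum_mset (Y j)#}"
  shows "count B 1 \<le> count A 1"
proof (rule ccontr)
  assume "\<not> ?thesis"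
  then have less: "count A 1 < count B 1" by simp
  \<comment> \<open>The component of an edge has at least two vertices, so the singleton added on
    either side never contributes a 1.\<close>
  have ones: "count A 1 + count (Y j) 1 = count B 1 + count (Y' j) 1" if "j \<in> J" for j
  proof -
    have "sum_mset (Y j) \<noteq> 1" "sum_mset (Y' j) \<noteq> 1"
      using forest_parts_pair[OF A that] forest_parts_pair[OF B that] by auto
    then show ?thesis using arg_cong[OF eq[OF that], of "\<lambda>M. count M 1"] by simp
  qed
  have le2: "count (Y j) 1 \<le> 2" if "j \<in> J" for j
    using forest_parts_pair[OF A that] by auto
  have isolated: "Y j = {#1, 1#} \<and> count (Y' j) 1 = 1" if "j \<in> J" "1 \<in># Y' j" for j
  proof -
    have "1 \<le> count (Y' j) 1" using that(2) by (simp add: Suc_le_eq)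
    then have "2 \<le> count (Y j) 1" "count (Y' j) 1 = 1"
      using ones[OF that(1)] less le2[OF that(1)] by linarith+
    then show ?thesis using forest_parts_all_ones[OF A that(1)] by blast
  qed
  have big: "3 \<le> sum_mset (Y' j)" if "j \<in> J" for j
    using forest_parts_cases[OF B that] isolated[OF that] by auto
  have B2: "count B 2 = 0"
    using forest_parts_edge[OF B, of 2] big by (force simp: count_eq_zero_iff)
  have "Y j = {#1, 1#} \<and> count A 2 = 2" if j: "j \<in> J" for j
  proof -
    let ?s = "sum_mset (Y' j)"
    obtain g h where gh: "g \<in> J" "h \<in> J" "g \<noteq> h" "Y' g = {#1, ?s - 1#}" "Y' h = {#1, ?s - 1#}"
      using forest_parts_two_leaves[OF B j big[OF j]] by blast
    have Y: "Y g = {#1, 1#}" "Y h = {#1, 1#}"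
      using isolated[of g] isolated[of h] gh by auto
    have "card {g, h} \<le> card {j \<in> J. Y j = {#1, 1#}}"
      using gh(1,2) Y J(1) by (intro card_mono) auto
    then have "2 \<le> count A 2" using forest_parts_isolated[OF A] gh(3) by simp
    \<comment> \<open>The multiplicity of 2 is compared in the equation for \<open>g\<close>, where
      \<open>B\<close> has no part 2 and \<open>?s\<close> is at least 3. With two isolated edges
      already found, this leaves only \<open>?s = 3\<close>.\<close>
    moreover have "count A 2 = (if ?s = 3 then 2 else 1)"
    proof -
      have "sum_mset (Y' g) = ?s" using gh(4) big[OF j] by simp
      then have "A + {#1, 1#} + {#?s#} = B + {#1, ?s - 1#} + {#2#}"
        using eq[OF gh(1)] gh(4) Y(1) by simp
      from arg_cong[OF this, of "\<lambda>M. count M 2"] show ?thesis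
        using B2 big[OF j] by (auto split: if_splits)
    qed
    ultimately have s: "?s = 3" "count A 2 = 2" by (auto split: if_splits)
    obtain y z where yz: "Y' j = {#y, z#}" "0 < y" "0 < z"
      using forest_parts_pair[OF B j] by blast
    then have "y = 1 \<or> z = 1" using s(1) by (simp, linarith)
    then have "1 \<in># Y' j" using yz by auto
    then show ?thesis using isolated[OF j] s(2) by blast
  qed
  moreover have "J \<noteq> {}" using J by auto
  ultimately have "{j \<in> J. Y j = {#1, 1#}} = J" "count A 2 = 2" by auto
  then show False using forest_parts_isolated[OF A] J(2) by simp
qed

text \<open>The component of \<open>f\<close> is smallest in both families. A leaf edge
  \<open>g\<close> of it is also a leaf edge in the second family, because the numbers of ones
  agree. Equal component sizes at \<open>g\<close> give \<open>A = B\<close>; a larger one would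
  force into \<open>B\<close> a part that is too small.\<close>

lemma refinements_smallest:
  assumes A: "forest_parts A J Y" and B: "forest_parts B J Y'"
    and eq: "\<And>j. j \<in> J \<Longrightarrow> A + Y j + {#sum_mset (Y' j)#} = B + Y' j + {#sum_mset (Y j)#}"
    and ones: "count A 1 = count B 1"
    and f: "f \<in> J" and min: "\<And>j. j \<in> J \<Longrightarrow> sum_mset (Y f) \<le> sum_mset (Y j)"
      "\<And>j. j \<in> J \<Longrightarrow> sum_mset (Y f) \<le> sum_mset (Y' j)"
  shows "A = B"
proof -
  let ?m = "sum_mset (Y f)"
  obtain g where g: "g \<in> J" "Y g = {#1, ?m - 1#}" using forest_parts_leaf[OF A f] by blast
  have m2: "2 \<le> ?m" using forest_parts_cases[OF A f] by auto
  have sum_g: "sum_mset (Y g) = ?m" using g(2) m2 by simp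
  obtain y z where yz: "Y' g = {#y, z#}" "0 < y" "0 < z" using forest_parts_pair[OF B g(1)] by blast
  have "sum_mset (Y' g) \<noteq> 1" using yz by simp
  then have "count (Y g) 1 = count (Y' g) 1"
    using arg_cong[OF eq[OF g(1)], of "\<lambda>M. count M 1"] ones sum_g m2 by simp
  then have "y = 1 \<or> z = 1" using yz g(2) by (auto split: if_splits)
  then obtain t where t: "Y' g = {#1, t#}" "0 < t" using yz by (auto simp: add_mset_commute)
  have eq': "A + {#1, ?m - 1#} + {#Suc t#} = B + {#1, t#} + {#?m#}"
    using eq[OF g(1)] sum_g g(2) t by simp
  show ?thesis
  proof (cases "Suc t = ?m")
    case True
    then have "?m - 1 = t" by simp
    then show ?thesis using eq' True by simp
  next
    case False
    have larger: "?m < Suc t" using min(2)[OF g(1)] t(1) False by simp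
    \<comment> \<open>If \<open>?m\<close> were 2, both parts at \<open>g\<close> would be 1, hence
      \<open>t = 1\<close>, against \<open>larger\<close>.\<close>
    have ones_t: "count {#1, ?m - 1#} 1 = count {#1, t#} 1"
      using \<open>count (Y g) 1 = count (Y' g) 1\<close> g(2) t(1) by simp
    then have m3: "3 \<le> ?m" using larger m2 by (auto split: if_splits)
    \<comment> \<open>\<open>?m - 1\<close> differs from 1, \<open>t\<close>, \<open>Suc t\<close>
      and \<open>?m\<close>, so it occurs once more in \<open>B\<close> than in \<open>A\<close>; a
      part of \<open>B\<close> of that size would be a component below the minimum.\<close>
    from arg_cong[OF eq', of "\<lambda>M. count M (?m - 1)"]
    have "count B (?m - 1) = Suc (count A (?m - 1))" using larger m3 by (auto split: if_splits)
    then have "?m - 1 \<in># B" by (metis count_inI nat.distinct(1))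
    moreover have "2 \<le> ?m - 1" using m3 by linarith
    ultimately obtain h where "h \<in> J" "sum_mset (Y' h) = ?m - 1"
      using forest_parts_edge[OF B] by blast
    then show ?thesis using min(2)[of h] m3 by linarith
  qed
qed

text \<open>The equation says that splitting at \<open>j\<close> turns \<open>A\<close> and
  \<open>B\<close> into the same partition, each removed part being carried to the opposite side. It
  is symmetric, so the family attaining the overall minimum may take the first role.\<close>

lemma refinements_determine:
  assumes A: "forest_parts A J Y" and B: "forest_parts B J Y'"
    and J: "finite J" "3 \<le> card J"
    and eq: "\<And>j. j \<in> J \<Longrightarrow> A + Y j + {#sum_mset (Y' j)#} = B + Y' j + {#sum_mset (Y j)#}"
  shows "A = B"
proof -
  note eq' = eq[symmetric]
  have ones: "count A 1 = count B 1"
    using refinements_count_ones[OF A B J eq] refinements_count_ones[OF B A J eq'] by simp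
  have J0: "J \<noteq> {}" using J by auto
  obtain f where f: "f \<in> J" "\<And>j. j \<in> J \<Longrightarrow> sum_mset (Y f) \<le> sum_mset (Y j)"
    using ex_min_if_finite[of "(\<lambda>j. sum_mset (Y j)) ` J"] J(1) J0 by (auto simp: not_less)
  obtain g where g: "g \<in> J" "\<And>j. j \<in> J \<Longrightarrow> sum_mset (Y' g) \<le> sum_mset (Y' j)"
    using ex_min_if_finite[of "(\<lambda>j. sum_mset (Y' j)) ` J"] J(1) J0 by (auto simp: not_less)
  show ?thesis
  proof (cases "sum_mset (Y f) \<le> sum_mset (Y' g)")
    case True
    show ?thesis
      by (rule refinements_smallest[OF A B eq ones f])
        (use True g(2) order_trans in \<open>blast+\<close>)
  next
    case False
    then have gf: "sum_mset (Y' g) \<le> sum_mset (Y f)" by simp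
    have "B = A"
      by (rule refinements_smallest[OF B A eq' ones[symmetric] g])
        (use gf f(2) order_trans in \<open>blast+\<close>)
    then show ?thesis by simp
  qed
qed

section \<open>Descent to smaller sets of deleted edges\<close>

lemma forest_parts_edges:
  assumes "forest V E" "inj_on e J" "e ` J = E"
  shows "forest_parts (theta V E {}) J (\<lambda>j. edge_parts E (e j))"
proof -
  have "card {j \<in> J. edge_parts E (e j) = {#1, 1#}} = card {f \<in> E. edge_parts E f = {#1, 1#}}"
  proof -
    have "{f \<in> E. edge_parts E f = {#1, 1#}} = e ` {j \<in> J. edge_parts E (e j) = {#1, 1#}}"
      using assms(3) by auto
    moreover have "inj_on e {j \<in> J. edge_parts E (e j) = {#1, 1#}}"
      using assms(2) by (rule inj_on_subset) auto
    ultimately show ?thesis by (simp add: card_image)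
  qed
  moreover have "\<exists>g\<in>J. \<exists>h\<in>J. g \<noteq> h
      \<and> edge_parts E (e g) = {#1, sum_mset (edge_parts E (e j)) - 1#}
      \<and> edge_parts E (e h) = {#1, sum_mset (edge_parts E (e j)) - 1#}"
    if j: "j \<in> J" and big: "3 \<le> sum_mset (edge_parts E (e j))" for j
  proof -
    obtain g h where gh: "g \<in> E" "h \<in> E" "g \<noteq> h"
      "edge_parts E g = {#1, sum_mset (edge_parts E (e j)) - 1#}"
      "edge_parts E h = {#1, sum_mset (edge_parts E (e j)) - 1#}"
      using two_leaf_edges[OF assms(1) _ big] assms(3) j by auto
    obtain a b where "a \<in> J" "g = e a" "b \<in> J" "h = e b" using gh(1,2) assms(3) by blast
    then show ?thesis using gh(3-5) by metis
  qed
  moreover have "\<forall>j\<in>J. \<exists>y z. edge_parts E (e j) = {#y, z#} \<and> 0 < y \<and> 0 < z"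
    using edge_parts_pos[OF forest_simple[OF assms(1)]] assms(3) by blast
  moreover have "\<forall>s\<in>#theta V E {}. 2 \<le> s \<longrightarrow> (\<exists>j\<in>J. sum_mset (edge_parts E (e j)) = s)"
    using edge_of_part[OF assms(1)] assms(3) by blast
  ultimately show ?thesis
    using isolated_edges_le[OF assms(1)] unfolding forest_parts_def by simp
qed

lemma theta_insert: "theta V E (insert f S) = theta V (E - S) {f}"
proof -
  have "E - insert f S = E - S - {f}" by auto
  then show ?thesis by (simp only: theta_def)
qed

text \<open>Deleting the edges labelled by \<open>I\<close> leaves a forest with at least three
  edges, labelled by \<open>N - I\<close>. The data for \<open>insert j I\<close> are its
  refinements at single edges, which determine its partition.\<close>

lemma theta_descent:
  fixes e :: "'i \<Rightarrow> 'a set" and e' :: "'i \<Rightarrow> 'b set"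
  assumes "forest V E" "bij_betw e N E" "forest V' E'" "bij_betw e' N E'"
    and "finite N" "I \<subseteq> N" "card I + 3 \<le> card N"
    and eq: "\<And>j. j \<in> N - I \<Longrightarrow> theta V E (e ` insert j I) = theta V' E' (e' ` insert j I)"
  shows "theta V E (e ` I) = theta V' E' (e' ` I)"
proof -
  let ?R = "E - e ` I" and ?R' = "E' - e' ` I"
  have inj: "inj_on e N" "inj_on e' N" "e ` N = E" "e' ` N = E'"
    using assms(2,4) by (auto simp: bij_betw_def)
  have R: "e ` (N - I) = ?R" "e' ` (N - I) = ?R'"
    using inj assms(6) by (auto simp: inj_on_image_set_diff[of _ N])
  have forest: "forest V ?R" "forest V' ?R'" using assms(1,3) forest_mono by blast+
  have "card (N - I) = card N - card I"
    using assms(5,6) by (intro card_Diff_subset) (auto intro: finite_subset)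
  then have J: "finite (N - I)" "3 \<le> card (N - I)" using assms(5,7) by auto
  have injJ: "inj_on e (N - I)" "inj_on e' (N - I)" using inj(1,2) by (simp_all add: inj_on_diff)
  have "theta V ?R {} = theta V' ?R' {}"
  proof (rule refinements_determine[OF forest_parts_edges[OF forest(1) injJ(1) R(1)]
        forest_parts_edges[OF forest(2) injJ(2) R(2)] J])
    fix j assume j: "j \<in> N - I"
    have in_R: "e j \<in> ?R" "e' j \<in> ?R'"
      using imageI[OF j, of e] imageI[OF j, of e'] unfolding R .
    then have "theta V ?R {e j} = theta V' ?R' {e' j}"
      using eq[OF j] by (simp only: image_insert theta_insert[of _ _ _ "e ` I"] theta_insert[of _ _ _ "e' ` I"])
    then show "theta V ?R {} + edge_parts ?R (e j) + {#sum_mset (edge_parts ?R' (e' j))#}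
        = theta V' ?R' {} + edge_parts ?R' (e' j) + {#sum_mset (edge_parts ?R (e j))#}"
      using theta_delete_edge[OF forest(1) in_R(1)] theta_delete_edge[OF forest(2) in_R(2)]
      by (simp flip: theta_delete_edge[OF forest(1) in_R(1)] theta_delete_edge[OF forest(2) in_R(2)])
  qed
  then show ?thesis by (simp add: theta_def)
qed

section \<open>Recovering adjacency of edges\<close>

text \<open>For an edge \<open>f\<close> of a tree, these are the ordered pairs whose path uses
  \<open>f\<close>.\<close>

definition separated :: "'a set \<Rightarrow> 'a set set \<Rightarrow> 'a set \<Rightarrow> ('a \<times> 'a) set" where
  "separated V E f = {(u, v) \<in> V \<times> V. (u, v) \<notin> (adj (E - {f}))\<^sup>*}"

text \<open>Since edges are bridges, a pair is cut by \<open>S\<close> only if a single member of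
  \<open>S\<close> cuts it. Otherwise \<open>u\<close> and \<open>v\<close> would reach opposite
  ends of some \<open>f\<close> without using \<open>f\<close>, and a connection of \<open>u\<close>
  to \<open>v\<close> avoiding \<open>f\<close> would then join those ends.\<close>

lemma conn_delete_set:
  assumes "forest V E" "finite S" "(u, v) \<in> (adj E)\<^sup>*"
  shows "(u, v) \<in> (adj (E - S))\<^sup>* \<longleftrightarrow> (\<forall>f\<in>S. (u, v) \<in> (adj (E - {f}))\<^sup>*)"
  using assms(2)
proof (induction S rule: finite_induct)
  case empty
  then show ?case using assms(3) by simp
next
  case (insert f S)
  have "(u, v) \<in> (adj (E - insert f S))\<^sup>*"
    if uv: "(u, v) \<in> (adj (E - S))\<^sup>*" "(u, v) \<in> (adj (E - {f}))\<^sup>*"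
  proof (rule ccontr)
    let ?Q = "E - insert f S" and ?F = "E - {f}"
    assume not: "(u, v) \<notin> (adj ?Q)\<^sup>*"
    \<comment> \<open>\<open>S\<close> may contain sets that are not edges; removing those changes
      nothing.\<close>
    have "E - insert f S = E - S" if "f \<notin> E" using that by auto
    then have "f \<in> E" using uv(1) not by metis
    then obtain x y where f: "f = {x, y}"
      using forest_simple[OF assms(1)] by (elim edge_endpoints)
    have Q: "E - S - {{x, y}} = ?Q" using f by auto
    have "(u, x) \<in> (adj ?Q)\<^sup>* \<and> (y, v) \<in> (adj ?Q)\<^sup>* \<or> (u, y) \<in> (adj ?Q)\<^sup>* \<and> (x, v) \<in> (adj ?Q)\<^sup>*"
      using conn_delete[OF uv(1), of x y] not unfolding Q by blast
    moreover have "?Q \<subseteq> ?F" by auto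
    ultimately have "(u, x) \<in> (adj ?F)\<^sup>* \<and> (y, v) \<in> (adj ?F)\<^sup>* \<or> (u, y) \<in> (adj ?F)\<^sup>* \<and> (x, v) \<in> (adj ?F)\<^sup>*"
      using conn_mono by metis
    then have "(x, y) \<in> (adj ?F)\<^sup>*"
      using uv(2) by (meson conn_sym rtrancl_trans)
    then show False using forest_bridge[OF assms(1)] \<open>f \<in> E\<close> f by blast
  qed
  moreover have "(u, v) \<in> (adj (E - S))\<^sup>* \<and> (u, v) \<in> (adj (E - {f}))\<^sup>*"
    if "(u, v) \<in> (adj (E - insert f S))\<^sup>*"
    using conn_mono[OF that, of "E - S"] conn_mono[OF that, of "E - {f}"] by auto
  ultimately show ?case using insert.IH by auto
qed

lemma sum_squares_theta:
  assumes "simple_graph V E"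
  shows "(\<Sum>s\<in>#theta V E S. s\<^sup>2) = card {(u, v) \<in> V \<times> V. (u, v) \<in> (adj (E - S))\<^sup>*}"
proof -
  have simple: "simple_graph V (E - S)" using assms by (auto simp: simple_graph_def)
  have fin: "finite V" using assms by (simp add: simple_graph_def)
  let ?C = "component (E - S) ` V"
  have sub: "component (E - S) v \<subseteq> V" if "v \<in> V" for v
    using component_subset[OF simple that] .
  have pairs: "{(u, v) \<in> V \<times> V. (u, v) \<in> (adj (E - S))\<^sup>*} = (\<Union>C\<in>?C. C \<times> C)"
  proof
    show "{(u, v) \<in> V \<times> V. (u, v) \<in> (adj (E - S))\<^sup>*} \<subseteq> (\<Union>C\<in>?C. C \<times> C)" by auto
    have "(p, q) \<in> (adj (E - S))\<^sup>*"
      if "p \<in> component (E - S) v" "q \<in> component (E - S) v" for p q v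
      using that component_eq by fastforce
    then show "(\<Union>C\<in>?C. C \<times> C) \<subseteq> {(u, v) \<in> V \<times> V. (u, v) \<in> (adj (E - S))\<^sup>*}"
      using sub by blast
  qed
  have "card (\<Union>C\<in>?C. C \<times> C) = (\<Sum>C\<in>?C. card (C \<times> C))"
  proof (rule card_UN_disjoint)
    show "finite ?C" using fin by simp
    show "\<forall>C\<in>?C. finite (C \<times> C)" using finite_component[OF simple] by auto
    have "C = D" if CD: "C \<in> ?C" "D \<in> ?C" and x: "x \<in> C" "x \<in> D" for C D x
    proof -
      obtain v w where "C = component (E - S) v" "D = component (E - S) w" using CD by blast
      then show ?thesis
        using component_eq[of x "E - S" v] component_eq[of x "E - S" w] x by simp
    qed
    then show "\<forall>C\<in>?C. \<forall>D\<in>?C. C \<noteq> D \<longrightarrow> C \<times> C \<inter> D \<times> D = {}" by blast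
  qed
  then show ?thesis
    unfolding pairs theta_def graph_components_eq[OF simple]
    by (simp add: power2_eq_square image_mset.compositionality comp_def sum_unfold_sum_mset
        card_cartesian_product)
qed

text \<open>The union consists of the pairs cut by \<open>S\<close>, the squares count the pairs
  left connected, and together these are all pairs. So \<open>theta\<close> determines the size of
  the union.\<close>

lemma card_separated:
  assumes "tree_graph V E" "finite S"
  shows "card (\<Union>f\<in>S. separated V E f) + (\<Sum>s\<in>#theta V E S. s\<^sup>2) = (card V)\<^sup>2"
proof -
  have forest: "forest V E" using assms(1) by (rule tree_imp_forest)
  have simple: "simple_graph V E" using assms(1) by (simp add: tree_graph_def)
  then have fin: "finite V" by (simp add: simple_graph_def)
  let ?P = "{(u, v) \<in> V \<times> V. (u, v) \<in> (adj (E - S))\<^sup>*}"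
  have conn: "(u, v) \<in> (adj E)\<^sup>*" if "u \<in> V" "v \<in> V" for u v
    using assms(1) that by (simp add: tree_graph_def connected_graph_def)
  have U: "(\<Union>f\<in>S. separated V E f) = V \<times> V - ?P"
    using conn_delete_set[OF forest assms(2) conn] by (auto simp: separated_def)
  have "card (V \<times> V - ?P) = card (V \<times> V) - card ?P"
    using fin by (intro card_Diff_subset) (auto intro: finite_subset[of _ "V \<times> V"])
  moreover have "card ?P \<le> card (V \<times> V)"
    using fin by (intro card_mono) auto
  ultimately show ?thesis
    unfolding U sum_squares_theta[OF simple] by (simp add: power2_eq_square card_cartesian_product)
qed

text \<open>\<open>A \<union> C\<close> and \<open>B \<union> C\<close> intersect in
  \<open>C \<union> A \<inter> B\<close>, which has the size of \<open>C\<close> exactly when the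
  inclusion holds. Only sizes of unions enter, and these are what \<open>theta\<close>
  provides.\<close>

lemma Int_subset_iff_card:
  assumes "finite A" "finite B" "finite C"
  shows "A \<inter> B \<subseteq> C \<longleftrightarrow> card (A \<union> C) + card (B \<union> C) = card C + card (A \<union> B \<union> C)"
proof -
  have "card (A \<union> C) + card (B \<union> C)
      = card ((A \<union> C) \<union> (B \<union> C)) + card ((A \<union> C) \<inter> (B \<union> C))"
    using assms by (intro card_Un_Int) auto
  moreover have "(A \<union> C) \<union> (B \<union> C) = A \<union> B \<union> C" "(A \<union> C) \<inter> (B \<union> C) = C \<union> A \<inter> B" by auto
  moreover have "card (C \<union> A \<inter> B) = card C \<longleftrightarrow> A \<inter> B \<subseteq> C"
    using assms card_subset_eq[of "C \<union> A \<inter> B" C] by (auto simp: Un_absorb2)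
  ultimately show ?thesis by auto
qed

lemma finite_separated: "simple_graph V E \<Longrightarrow> finite (separated V E f)"
  unfolding separated_def simple_graph_def by (auto intro: finite_subset[of _ "V \<times> V"])

text \<open>If \<open>f\<close> and \<open>g\<close> are disjoint, some edge \<open>h\<close>
  between them lies on every path through both. If they share a vertex, the path formed by
  \<open>f\<close> and \<open>g\<close> alone avoids every other edge.\<close>

lemma adjacent_iff_separated:
  assumes "forest V E" "connected_graph V E" "f \<in> E" "g \<in> E" "f \<noteq> g"
  shows "f \<inter> g = {} \<longleftrightarrow> (\<exists>h\<in>E - {f, g}. separated V E f \<inter> separated V E g \<subseteq> separated V E h)"
proof
  have simple: "simple_graph V E" using assms(1) by (rule forest_simple)
  have finE: "finite E" using simple by (rule finite_edges)
  {
    assume disj: "f \<inter> g = {}"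
    obtain x y where f: "f = {x, y}" "y \<in> V" using simple assms(3) by (elim edge_endpoints)
    obtain u v where g: "g = {u, v}" "u \<in> V" using simple assms(4) by (elim edge_endpoints)
    \<comment> \<open>With only \<open>f\<close> and \<open>g\<close> kept, \<open>y\<close> cannot
      leave \<open>f\<close>. So deleting all other edges cuts \<open>y\<close> from
      \<open>u\<close>, and by \<open>conn_delete_set\<close> a single one of them does.\<close>
    have "w \<in> f" if "(y, w) \<in> (adj {f, g})\<^sup>*" for w
      using that
    proof (induction rule: rtrancl_induct)
      case (step a b)
      then show ?case using disj by (auto simp: adj_def)
    qed (use f in simp)
    then have "(y, u) \<notin> (adj {f, g})\<^sup>*" using disj g by auto
    moreover have "E - (E - {f, g}) = {f, g}" using assms(3,4) by auto
    moreover have "(y, u) \<in> (adj E)\<^sup>*"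
      using assms(2) f(2) g(2) by (simp add: connected_graph_def)
    ultimately obtain h where h: "h \<in> E - {f, g}" "(y, u) \<notin> (adj (E - {h}))\<^sup>*"
      using conn_delete_set[OF assms(1), of "E - {f, g}" y u] finE by auto
    \<comment> \<open>A connection that avoids \<open>h\<close> but cannot avoid
      \<open>{a, b}\<close> runs through that edge, so \<open>p\<close> reaches \<open>a\<close>
      without \<open>h\<close>.\<close>
    have through: "(p, a) \<in> (adj (E - {h}))\<^sup>*"
      if pq: "(p, q) \<in> (adj (E - {h}))\<^sup>*" "(p, q) \<notin> (adj (E - {{a, b}}))\<^sup>*" "{a, b} \<in> E - {h}"
      for p q a b
    proof -
      let ?Q = "E - {h} - {{a, b}}"
      have "(p, q) \<notin> (adj ?Q)\<^sup>*" using conn_mono[of p q ?Q "E - {{a, b}}"] pq(2) by blast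
      then have "(p, a) \<in> (adj ?Q)\<^sup>* \<or> (p, b) \<in> (adj ?Q)\<^sup>*"
        using conn_delete[OF pq(1), of a b] by blast
      then have "(p, a) \<in> (adj (E - {h}))\<^sup>* \<or> (p, b) \<in> (adj (E - {h}))\<^sup>*"
        using conn_mono[of p _ ?Q "E - {h}"] by blast
      moreover have "(b, a) \<in> (adj (E - {h}))\<^sup>*" using conn_sym[OF conn_edge[OF pq(3)]] .
      ultimately show ?thesis using rtrancl_trans[of p b _ a] by blast
    qed
    have "(p, q) \<notin> (adj (E - {h}))\<^sup>*"
      if "(p, q) \<notin> (adj (E - {f}))\<^sup>*" "(p, q) \<notin> (adj (E - {g}))\<^sup>*" for p q
    proof
      assume pq: "(p, q) \<in> (adj (E - {h}))\<^sup>*"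
      have "(p, y) \<in> (adj (E - {h}))\<^sup>*"
        using through[OF pq, of y x] that(1) f h(1) assms(3) by (auto simp: insert_commute)
      moreover have "(p, u) \<in> (adj (E - {h}))\<^sup>*"
        using through[OF pq, of u v] that(2) g h(1) assms(4) by auto
      ultimately have "(y, u) \<in> (adj (E - {h}))\<^sup>*"
        using conn_sym[of p y] rtrancl_trans[of y p _ u] by blast
      then show False using h(2) by simp
    qed
    then show "\<exists>h\<in>E - {f, g}. separated V E f \<inter> separated V E g \<subseteq> separated V E h"
      using h(1) by (intro bexI[of _ h]) (auto simp: separated_def)
  }
  {
    assume "\<exists>h\<in>E - {f, g}. separated V E f \<inter> separated V E g \<subseteq> separated V E h"
    then obtain h where h: "h \<in> E" "h \<noteq> f" "h \<noteq> g"
      "separated V E f \<inter> separated V E g \<subseteq> separated V E h" by auto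
    show "f \<inter> g = {}"
    proof (rule ccontr)
      assume "f \<inter> g \<noteq> {}"
      then obtain y where y: "y \<in> f" "y \<in> g" by auto
      obtain x where f: "f = {x, y}"
        using other_endpoint[OF simple assms(3) y(1)] by (metis insert_commute)
      obtain z where g: "g = {y, z}" using other_endpoint[OF simple assms(4) y(2)] by blast
      have V: "x \<in> V" "z \<in> V" using simple assms(3,4) f g by (auto simp: simple_graph_def)
      have edge: "(x, y) \<in> (adj (E - {k}))\<^sup>*" if "k \<noteq> f" for k
        using assms(3) f that by (intro conn_edge) auto
      have edge': "(y, z) \<in> (adj (E - {k}))\<^sup>*" if "k \<noteq> g" for k
        using assms(4) g that by (intro conn_edge) auto
      have "(x, z) \<notin> (adj (E - {f}))\<^sup>*"
        using forest_bridge[OF assms(1), of x y] assms(3,5) f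
          conn_sym[OF edge'[of f]] rtrancl_trans[of x z _ y] by blast
      moreover have "(x, z) \<notin> (adj (E - {g}))\<^sup>*"
        using forest_bridge[OF assms(1), of y z] assms(4,5) g
          conn_sym[OF edge[of g]] rtrancl_trans[of y x _ z] by blast
      moreover have "(x, z) \<in> (adj (E - {h}))\<^sup>*"
        using edge[of h] edge'[of h] h(2,3) by (meson rtrancl_trans)
      ultimately show False using h(4) V by (auto simp: separated_def)
    qed
  }
qed

section \<open>Recovering a tree from adjacency of its edges\<close>

abbreviation incident :: "'a set set \<Rightarrow> 'a \<Rightarrow> 'a set set" where
  "incident E v \<equiv> {f \<in> E. v \<in> f}"

lemma edge_eq:
  assumes "simple_graph V E" "f \<in> E" "v \<in> f" "w \<in> f" "v \<noteq> w"
  shows "f = {v, w}"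
  using assms(1,2)
proof (rule edge_endpoints)
  fix x y assume "f = {x, y}"
  then show ?thesis using assms(3-5) by auto
qed

lemma common_vertex_unique:
  assumes "simple_graph V E" "f \<in> E" "g \<in> E" "f \<noteq> g" "v \<in> f" "v \<in> g" "w \<in> f" "w \<in> g"
  shows "v = w"
  using edge_eq[OF assms(1,2,5,7)] edge_eq[OF assms(1,3,6,8)] assms(4) by blast

lemma edge_iff_incident:
  assumes "simple_graph V E" "a \<noteq> b"
  shows "{a, b} \<in> E \<longleftrightarrow> incident E a \<inter> incident E b \<noteq> {}"
proof
  assume "incident E a \<inter> incident E b \<noteq> {}"
  then obtain f where f: "f \<in> E" "a \<in> f" "b \<in> f" by auto
  then have "f = {a, b}" using edge_eq assms by metis
  then show "{a, b} \<in> E" using f by simp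
qed auto

text \<open>Two distinct members \<open>f\<close> and \<open>g\<close> fix a common vertex
  \<open>y\<close>. A member avoiding \<open>y\<close> would join their other ends and complete a
  triangle, so it would not be a bridge.\<close>

lemma pairwise_intersecting_edges:
  assumes "forest V E" "K \<subseteq> E" "f \<in> K" "g \<in> K" "f \<noteq> g"
    and meet: "\<And>h k. h \<in> K \<Longrightarrow> k \<in> K \<Longrightarrow> h \<inter> k \<noteq> {}"
  shows "\<exists>v\<in>V. \<forall>h\<in>K. v \<in> h"
proof -
  have simple: "simple_graph V E" using assms(1) by (rule forest_simple)
  have E: "f \<in> E" "g \<in> E" using assms by auto
  obtain y where y: "y \<in> f" "y \<in> g" using meet[OF assms(3,4)] by auto
  obtain x where f: "f = {x, y}"
    using other_endpoint[OF simple E(1) y(1)] by (metis insert_commute)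
  obtain z where g: "g = {y, z}" using other_endpoint[OF simple E(2) y(2)] by blast
  have "y \<in> h" if h: "h \<in> K" for h
  proof (rule ccontr)
    assume "y \<notin> h"
    then have "x \<in> h" "z \<in> h" using meet[OF h assms(3)] meet[OF h assms(4)] f g by auto
    moreover have "x \<noteq> z" using f g assms(5) by (auto simp: insert_commute)
    moreover have hE: "h \<in> E" using h assms(2) by auto
    ultimately have "h = {x, z}" using edge_eq[OF simple] by blast
    moreover have "(x, y) \<in> (adj (E - {h}))\<^sup>*" "(y, z) \<in> (adj (E - {h}))\<^sup>*"
      using E f g \<open>y \<notin> h\<close> by (auto intro!: conn_edge)
    ultimately show False
      using forest_bridge[OF assms(1), of x z] hE by (meson rtrancl_trans)
  qed
  moreover have "y \<in> V" using simple E(1) y(1) by (auto simp: simple_graph_def)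
  ultimately show ?thesis by blast
qed

lemma incident_nonempty:
  assumes "connected_graph V E" "2 \<le> card V" "v \<in> V"
  shows "incident E v \<noteq> {}"
proof -
  obtain u where "u \<in> V" "u \<noteq> v"
    using assms(2,3) by (metis card_2_iff' card_le_Suc0_iff_eq card.infinite not_less_eq_eq
        numeral_2_eq_2 not_numeral_le_zero)
  then have "(v, u) \<in> (adj E)\<^sup>*" using assms by (simp add: connected_graph_def)
  then obtain w where "{v, w} \<in> E"
    using \<open>u \<noteq> v\<close> by (metis adj_def case_prodD converse_rtranclE mem_Collect_eq)
  then show ?thesis by auto
qed

lemma no_isolated_edge:
  assumes "connected_graph V E" "3 \<le> card V" "u \<in> V" "{u, v} \<in> E"
  shows "incident E u \<noteq> {{u, v}} \<or> incident E v \<noteq> {{u, v}}"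
proof (rule ccontr)
  assume "\<not> ?thesis"
  then have inc: "incident E u = {{u, v}}" "incident E v = {{u, v}}" by auto
  have "w \<in> {u, v}" if "(u, w) \<in> (adj E)\<^sup>*" for w
    using that
  proof (induction rule: rtrancl_induct)
    case (step a b)
    then have "{a, b} \<in> incident E u \<or> {a, b} \<in> incident E v" by (auto simp: adj_def)
    then have "{a, b} = {u, v}" unfolding inc by simp
    then show ?case by auto
  qed simp
  then have "V \<subseteq> {u, v}" using assms(1,3) by (auto simp: connected_graph_def)
  then have "card V \<le> card {u, v}" by (intro card_mono) auto
  also have "\<dots> \<le> 2" by (simp add: card_insert_if)
  finally show False using assms(2) by simp
qed

text \<open>Two vertices with the same incident edges can share only the edge joining them, which
  would then be a whole component. The bound 3 excludes the tree with a single edge.\<close>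

lemma inj_on_incident:
  assumes "simple_graph V E" "connected_graph V E" "3 \<le> card V"
  shows "inj_on (incident E) V"
proof (rule inj_onI, rule ccontr)
  fix v w assume vw: "v \<in> V" "w \<in> V" "incident E v = incident E w" "v \<noteq> w"
  obtain f where f: "f \<in> incident E v"
    using incident_nonempty[OF assms(2) _ vw(1)] assms(3) by fastforce
  have "g = f" if "g \<in> incident E v" for g
    using common_vertex_unique[OF assms(1), of f g v w] f that vw by blast
  then have inc: "incident E v = {f}" using f by blast
  have fE: "f \<in> E" "v \<in> f" using f by auto
  have "w \<in> f" using f[unfolded vw(3)] by auto
  then have f_eq: "f = {v, w}" using edge_eq[OF assms(1) fE _ vw(4)] by simp
  have "incident E w = {f}" using inc vw(3) by (rule trans[OF sym, rotated])
  then show False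
    using no_isolated_edge[OF assms(2,3) vw(1), of w] inc fE(1) unfolding f_eq by blast
qed

text \<open>The image of the edges at \<open>v\<close> meets pairwise, hence has a common vertex
  \<open>v'\<close>. The same argument applied backwards shows that no further edge at
  \<open>v'\<close> occurs.\<close>

lemma incident_image_branch:
  assumes "forest V E" "forest V' E'" "bij_betw \<phi> E E'"
    and meet: "\<And>f g. f \<in> E \<Longrightarrow> g \<in> E \<Longrightarrow> f \<inter> g = {} \<longleftrightarrow> \<phi> f \<inter> \<phi> g = {}"
    and "f \<in> incident E v" "g \<in> incident E v" "f \<noteq> g"
  shows "\<exists>v'\<in>V'. incident E' v' = \<phi> ` incident E v"
proof -
  have inj: "inj_on \<phi> E" and im: "\<phi> ` E = E'" using assms(3) by (auto simp: bij_betw_def)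
  have "\<phi> f \<noteq> \<phi> g" using inj assms(5-7) by (auto simp: inj_on_def)
  moreover have "h \<inter> k \<noteq> {}" if "h \<in> \<phi> ` incident E v" "k \<in> \<phi> ` incident E v" for h k
    using that meet by blast
  ultimately obtain v' where v': "v' \<in> V'" "\<forall>h\<in>\<phi> ` incident E v. v' \<in> h"
    using pairwise_intersecting_edges[OF assms(2), of "\<phi> ` incident E v" "\<phi> f" "\<phi> g"] im assms(5,6)
    by blast
  \<comment> \<open>All edges sent to \<open>v'\<close>: they also meet pairwise, and containing
    \<open>f\<close> and \<open>g\<close> their common vertex can only be \<open>v\<close>.\<close>
  define K where "K = {h \<in> E. v' \<in> \<phi> h}"
  have K: "K \<subseteq> E" "incident E v \<subseteq> K" using v'(2) by (auto simp: K_def)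
  have "h \<inter> k \<noteq> {}" if "h \<in> K" "k \<in> K" for h k
    using that meet[of h k] by (auto simp: K_def)
  then obtain w where w: "\<forall>h\<in>K. w \<in> h"
    using pairwise_intersecting_edges[OF assms(1) K(1), of f g] K(2) assms(5-7) by blast
  have "w = v"
    using common_vertex_unique[OF forest_simple[OF assms(1)], of f g w v] w K(2) assms(5-7) by blast
  then have "K = incident E v" using w K by blast
  moreover have "incident E' v' = \<phi> ` K" using im by (auto simp: K_def)
  ultimately show ?thesis using v'(1) by blast
qed

text \<open>A leaf \<open>v\<close> is treated through its neighbour \<open>u\<close>, which has a
  second edge: the edges at \<open>u\<close> go to those at some \<open>u'\<close>, and the other
  end \<open>w'\<close> of the image of \<open>f\<close> turns out to be a leaf.\<close>

lemma incident_image: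
  assumes T: "forest V E" "connected_graph V E" "3 \<le> card V"
    and T': "forest V' E'" "connected_graph V' E'" "3 \<le> card V'"
    and bij: "bij_betw \<phi> E E'"
    and meet: "\<And>f g. f \<in> E \<Longrightarrow> g \<in> E \<Longrightarrow> f \<inter> g = {} \<longleftrightarrow> \<phi> f \<inter> \<phi> g = {}"
    and v: "v \<in> V"
  shows "\<exists>v'\<in>V'. incident E' v' = \<phi> ` incident E v"
proof (cases "\<exists>f\<in>incident E v. \<exists>g\<in>incident E v. f \<noteq> g")
  case True
  then obtain f g where fg: "f \<in> incident E v" "g \<in> incident E v" "f \<noteq> g" by blast
  show ?thesis by (rule incident_image_branch[OF T(1) T'(1) bij meet fg])
next
  case False
  have simple: "simple_graph V E" "simple_graph V' E'" using T(1) T'(1) by (auto intro: forest_simple)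
  obtain f where f: "f \<in> E" "v \<in> f"
    using incident_nonempty[OF T(2) _ v] T(3) by fastforce
  then have inc_v: "incident E v = {f}" using False by blast
  obtain u where u: "f = {v, u}" using other_endpoint[OF simple(1) f] by blast
  have "incident E u \<noteq> {f}" using no_isolated_edge[OF T(2,3) v, of u] inc_v f u by auto
  then obtain g where g: "g \<in> incident E u" "g \<noteq> f" using f u by blast
  have fu: "f \<in> incident E u" using f u by auto
  obtain u' where u': "u' \<in> V'" "incident E' u' = \<phi> ` incident E u"
    using incident_image_branch[OF T(1) T'(1) bij meet fu g(1)] g(2) by metis
  have inj: "inj_on \<phi> E" and im: "\<phi> ` E = E'" using bij by (auto simp: bij_betw_def)
  have fE': "\<phi> f \<in> E'" using im f by auto
  have "u' \<in> \<phi> f" using u'(2) fu by blast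
  then obtain w' where w': "\<phi> f = {u', w'}" "u' \<noteq> w'" "w' \<in> V'"
    using other_endpoint[OF simple(2) fE'] by blast
  have "incident E' w' = {\<phi> f}"
  proof (rule ccontr)
    \<comment> \<open>Were \<open>w'\<close> not a leaf, the branch case for the inverse map would
      give a vertex \<open>w\<close> of \<open>f\<close> with several edges. It cannot be
      \<open>v\<close>, and \<open>w = u\<close> would give \<open>u'\<close> and \<open>w'\<close>
      the same incident edges.\<close>
    assume "incident E' w' \<noteq> {\<phi> f}"
    moreover have fw': "\<phi> f \<in> incident E' w'" using fE' w' by auto
    ultimately obtain k where k: "k \<in> incident E' w'" "k \<noteq> \<phi> f" by blast
    let ?\<psi> = "inv_into E \<phi>"
    have \<psi>: "bij_betw ?\<psi> E' E" using bij by (rule bij_betw_inv_into)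
    have \<psi>E: "?\<psi> h \<in> E" "\<phi> (?\<psi> h) = h" if "h \<in> E'" for h
      using that im by (auto simp: inv_into_into f_inv_into_f)
    have meet': "h \<inter> l = {} \<longleftrightarrow> ?\<psi> h \<inter> ?\<psi> l = {}" if "h \<in> E'" "l \<in> E'" for h l
      using meet[of "?\<psi> h" "?\<psi> l"] \<psi>E that by simp
    obtain w where w: "w \<in> V" "incident E w = ?\<psi> ` incident E' w'"
      using incident_image_branch[OF T'(1) T(1) \<psi> meet' fw' k(1)] k(2) by metis
    have "f \<in> incident E w" using w(2) fw' inv_into_f_f[OF inj f(1)] by (metis image_eqI)
    then have "w = v \<or> w = u" using u by auto
    moreover have "?\<psi> k \<in> incident E w" "?\<psi> k \<noteq> f" using w(2) k \<psi>E[of k] by auto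
    ultimately have "w = u" using inc_v by blast
    then have "\<phi> ` incident E u = incident E' w'"
      using w(2) \<psi>E by (force simp: image_image)
    then have "incident E' w' = incident E' u'" using u'(2) by simp
    then show False
      using inj_onD[OF inj_on_incident[OF simple(2) T'(2,3)]] w'(2,3) u'(1) by blast
  qed
  then show ?thesis using inc_v w'(3) by auto
qed

text \<open>Vertices are matched through their sets of incident edges. These distinguish vertices,
  so the map is injective, and equal cardinalities make it onto; two vertices are adjacent when
  their sets meet.\<close>

lemma adjacency_determines_tree:
  assumes T: "forest V E" "connected_graph V E" "3 \<le> card V"
    and T': "forest V' E'" "connected_graph V' E'" "card V' = card V"
    and bij: "bij_betw \<phi> E E'"
    and meet: "\<And>f g. f \<in> E \<Longrightarrow> g \<in> E \<Longrightarrow> f \<inter> g = {} \<longleftrightarrow> \<phi> f \<inter> \<phi> g = {}"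
  shows "graph_isomorphic V E V' E'"
proof -
  have simple: "simple_graph V E" "simple_graph V' E'" using T(1) T'(1) by (auto intro: forest_simple)
  have card': "3 \<le> card V'" using T(3) T'(3) by simp
  obtain F where F: "\<And>v. v \<in> V \<Longrightarrow> F v \<in> V'"
    "\<And>v. v \<in> V \<Longrightarrow> incident E' (F v) = \<phi> ` incident E v"
    using incident_image[OF T T'(1,2) card' bij meet] by metis
  have inj: "inj_on \<phi> E" using bij by (simp add: bij_betw_def)
  have inc_eq: "incident E u = incident E v" if "\<phi> ` incident E u = \<phi> ` incident E v" for u v
    using inj_on_image_eq_iff[OF inj, of "incident E u" "incident E v"] that by auto
  have injF: "inj_on F V"
  proof (rule inj_onI)
    fix u v assume uv: "u \<in> V" "v \<in> V" "F u = F v"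
    have "\<phi> ` incident E u = \<phi> ` incident E v"
      unfolding F(2)[OF uv(1), symmetric] F(2)[OF uv(2), symmetric] uv(3) ..
    then show "u = v"
      using inj_onD[OF inj_on_incident[OF simple(1) T(2,3)] inc_eq uv(1,2)] by blast
  qed
  have fin: "finite V" "finite V'" using simple by (auto simp: simple_graph_def)
  have "F ` V = V'"
    using F(1) fin T'(3) card_image[OF injF] by (intro card_subset_eq) auto
  then have "bij_betw F V V'" using injF by (simp add: bij_betw_def)
  moreover have "{u, v} \<in> E \<longleftrightarrow> {F u, F v} \<in> E'" if uv: "u \<in> V" "v \<in> V" for u v
  proof (cases "u = v")
    case True
    then show ?thesis using simple by (auto simp: simple_graph_def)
  next
    case False
    have "F u \<noteq> F v" using inj_onD[OF injF] uv False by blast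
    then show ?thesis
      using edge_iff_incident[OF simple(1) False] edge_iff_incident[OF simple(2)] F(2) uv
        inj_on_image_Int[OF inj, of "incident E u" "incident E v"] by auto
  qed
  ultimately show ?thesis unfolding graph_isomorphic_def by blast
qed

theorem corollary2p4:
  fixes V :: "'a set" and E :: "'a set set"
    and V' :: "'b set" and E' :: "'b set set"
    and e :: "nat \<Rightarrow> 'a set" and e' :: "nat \<Rightarrow> 'b set"
    and n k :: nat
  assumes "n \<ge> 4"
    and "3 \<le> k" and "k \<le> n - 3"
    and "tree_graph V E" and "card V = n" and "bij_betw e {1..n - 1} E"
    and "tree_graph V' E'" and "card V' = n" and "bij_betw e' {1..n - 1} E'"
    and "\<And>I. I \<subseteq> {1..n - 1} \<Longrightarrow> card I = k \<Longrightarrow> theta V E (e ` I) = theta V' E' (e' ` I)"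
  shows "graph_isomorphic V E V' E'"
proof -
  let ?N = "{1..n - 1}"
  have forest: "forest V E" "forest V' E'" using assms(4,7) by (auto intro: tree_imp_forest)
  have conn: "connected_graph V E" "connected_graph V' E'"
    using assms(4,7) by (auto simp: tree_graph_def)
  have theta_eq: "theta V E (e ` I) = theta V' E' (e' ` I)"
    if "m \<le> k" "I \<subseteq> ?N" "card I = m" for m I
    using that
  proof (induction m arbitrary: I rule: inc_induct)
    case base
    then show ?case using assms(10) by simp
  next
    case (step m)
    show ?case
    proof (rule theta_descent[OF forest(1) assms(6) forest(2) assms(9)])
      \<comment> \<open>From \<open>m < k\<close> and \<open>k \<le> n - 3\<close>, at least three
        of the \<open>n - 1\<close> edges remain.\<close>
      show "card I + 3 \<le> card ?N" using step.hyps(2) step.prems(2) assms(1,3) by simp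
      fix j assume "j \<in> ?N - I"
      moreover have "finite I" using step.prems(1) finite_subset by blast
      ultimately show "theta V E (e ` insert j I) = theta V' E' (e' ` insert j I)"
        using step.prems by (intro step.IH) auto
    qed (use step.prems in auto)
  qed
  \<comment> \<open>Here \<open>3 \<le> k\<close> enters: the descent has reached all sets of at
    most three labels.\<close>
  have card_eq: "card (\<Union>i\<in>I. separated V E (e i)) = card (\<Union>i\<in>I. separated V' E' (e' i))"
    if "I \<subseteq> ?N" "card I \<le> 3" for I
  proof -
    have "finite I" using that(1) finite_subset by blast
    then show ?thesis
      using card_separated[OF assms(4), of "e ` I"] card_separated[OF assms(7), of "e' ` I"]
        theta_eq[of "card I" I] that assms(2,5,8) by simp
  qed
  define \<phi> where "\<phi> = e' \<circ> inv_into ?N e"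
  have \<phi>: "bij_betw \<phi> E E'"
    unfolding \<phi>_def using bij_betw_inv_into[OF assms(6)] assms(9) by (rule bij_betw_trans)
  have inj: "inj_on e ?N" "inj_on e' ?N" and im: "e ` ?N = E" "e' ` ?N = E'"
    using assms(6,9) by (auto simp: bij_betw_def)
  have \<phi>_e: "\<phi> (e i) = e' i" if "i \<in> ?N" for i
    using inv_into_f_f[OF inj(1) that] by (simp add: \<phi>_def)
  \<comment> \<open>By \<open>Int_subset_iff_card\<close> this depends only on unions over at most
    three labels; repeated labels only make these sets smaller.\<close>
  have sep: "separated V E (e a) \<inter> separated V E (e b) \<subseteq> separated V E (e c)
      \<longleftrightarrow> separated V' E' (e' a) \<inter> separated V' E' (e' b) \<subseteq> separated V' E' (e' c)"
    if "a \<in> ?N" "b \<in> ?N" "c \<in> ?N" for a b c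
  proof -
    have "card {a, b, c} \<le> 3" "card {a, c} \<le> 3" "card {b, c} \<le> 3" "card {c} \<le> 3"
      by (auto simp: card_insert_if)
    then show ?thesis
      using card_eq[of "{a, b, c}"] card_eq[of "{a, c}"] card_eq[of "{b, c}"] card_eq[of "{c}"] that
        finite_separated[OF forest_simple[OF forest(1)]] finite_separated[OF forest_simple[OF forest(2)]]
      by (simp add: Int_subset_iff_card Un_assoc)
  qed
  have in_E: "e a \<in> E" "e' a \<in> E'" if "a \<in> ?N" for a
    using imageI[OF that, of e] imageI[OF that, of e'] unfolding im .
  have meet: "e a \<inter> e b = {} \<longleftrightarrow> e' a \<inter> e' b = {}" if ab: "a \<in> ?N" "b \<in> ?N" for a b
  proof (cases "a = b")
    case True
    have "{} \<notin> E" "{} \<notin> E'" using forest by (auto simp: forest_def simple_graph_def)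
    then have "e a \<noteq> {}" "e' a \<noteq> {}" using in_E[OF ab(1)] by auto
    then show ?thesis using True by simp
  next
    case False
    then have ne: "e a \<noteq> e b" "e' a \<noteq> e' b" using inj ab by (auto simp: inj_on_def)
    have others: "E - {e a, e b} = e ` (?N - {a, b})" "E' - {e' a, e' b} = e' ` (?N - {a, b})"
      using inj_on_image_set_diff[OF inj(1), of ?N "{a, b}"]
        inj_on_image_set_diff[OF inj(2), of ?N "{a, b}"] im ab by simp_all
    show ?thesis
      unfolding adjacent_iff_separated[OF forest(1) conn(1) in_E(1)[OF ab(1)] in_E(1)[OF ab(2)] ne(1)]
        adjacent_iff_separated[OF forest(2) conn(2) in_E(2)[OF ab(1)] in_E(2)[OF ab(2)] ne(2)] others
      using sep ab by auto
  qed
  show ?thesis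
  proof (rule adjacency_determines_tree[OF forest(1) conn(1) _ forest(2) conn(2) _ \<phi>])
    fix f g assume "f \<in> E" "g \<in> E"
    then obtain a b where "a \<in> ?N" "f = e a" "b \<in> ?N" "g = e b" using im(1) by blast
    then show "f \<inter> g = {} \<longleftrightarrow> \<phi> f \<inter> \<phi> g = {}" using meet \<phi>_e by simp
  qed (use assms in auto)
qed

end
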